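(* For each $n$ and $p=p(n)\in[0,1]$, let $\mathcal{A}\subseteq S_{n+1}$ be the random set obtained by choosing each $\rho\in S_{n+1}$ independently with probability $p$. Let $X$ be the number of permutations $\pi\in S_n$ that are not covered by any element of $\mathcal{A}$, and let $\lambda=\mathbb{E}(X)$. Let $\epsilon>0$ be arbitrary. If $p\ge\frac{\log n}{n^2}(1+\epsilon)$, then $$d_{\mathrm{TV}}(\mathcal{L}(X),\mathrm{Po}(\lambda))\to0\qquad(n\to\infty).$$
   Context: $S_n$ is the set of all permutations of $[n]=\{1,2,\ldots,n\}$, written as words. A permutation $\rho\in S_{n+1}$ covers $\pi\in S_n$ if $\rho$ has a (not necessarily contiguous) subsequence of length $n$ that is order-isomorphic to $\pi$. $\mathcal{L}(X)$ is the probability distribution of $X$; $\mathrm{Po}(\lambda)$ is the Poisson distribution with parameter $\lambda$ (for $\lambda=0$, the point mass at $0$). For random variables $Y,Z$ with values in the nonnegative integers, the total variation distance is $d_{\mathrm{TV}}(\mathcal{L}(Y),\mathcal{L}(Z))=\sup_{A}|\mathbb{P}(Y\in A)-\mathbb{P}(Z\in A)|$, the supremum being over all sets $A$ of nonnegative integers. $\log$ is the natural logarithm. *)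

theory Defs
  imports
    "HOL-Probability.Probability"
    "HOL-Combinatorics.Multiset_Permutations"
    "HOL-Library.Sublist"
begin

abbreviation Sn :: "nat \<Rightarrow> nat list set" where
  "Sn n \<equiv> permutations_of_set {1..n}"

definition order_isomorphic :: "nat list \<Rightarrow> nat list \<Rightarrow> bool" where
  "order_isomorphic xs ys \<longleftrightarrow>
     length xs = length ys \<and>
     (\<forall>i<length xs. \<forall>j<length xs. xs ! i < xs ! j \<longleftrightarrow> ys ! i < ys ! j)"

(* Meant for \<rho> one entry longer than \<pi>. The length of the subsequence \<sigma> is forced
   by order isomorphism. *)
definition covers :: "nat list \<Rightarrow> nat list \<Rightarrow> bool" where
  "covers \<rho> \<pi> \<longleftrightarrow> (\<exists>\<sigma>. subseq \<sigma> \<rho> \<and> order_isomorphic \<sigma> \<pi>)"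

(* The default value False outside S is irrelevant, since only elements of S are collected. *)
definition random_subset_pmf :: "'a set \<Rightarrow> real \<Rightarrow> 'a set pmf" where
  "random_subset_pmf S q =
     map_pmf (\<lambda>f. {x \<in> S. f x}) (Pi_pmf S False (\<lambda>_. bernoulli_pmf q))"

definition num_uncovered :: "nat \<Rightarrow> nat list set \<Rightarrow> nat" where
  "num_uncovered n \<A> = card {\<pi> \<in> Sn n. \<not> (\<exists>\<rho>\<in>\<A>. covers \<rho> \<pi>)}"

(* The library's poisson_pmf is only specified for positive rates. *)
definition Po :: "real \<Rightarrow> nat pmf" where
  "Po r = (if r = 0 then return_pmf 0 else poisson_pmf r)"

definition d_TV :: "nat pmf \<Rightarrow> nat pmf \<Rightarrow> real" where
  "d_TV P Q = (SUP A. \<bar>measure_pmf.prob P A - measure_pmf.prob Q A\<bar>)"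

end

theory Submission imports Defs "HOL-Real_Asymp.Real_Asymp" begin

text \<open>
  Write \<open>C \<pi>\<close> for the set of permutations in \<open>S\<^bsub>n+1\<^esub>\<close> covering \<open>\<pi>\<close>. Conditioning on \<open>\<pi>\<close> being
  uncovered amounts to replacing \<open>\<A>\<close> by \<open>\<A> - C \<pi>\<close>, which is a monotone coupling. The Stein--Chen
  method with this coupling bounds the total variation distance by the maximum over \<open>\<pi>\<close> of
  \<open>(1-p)\<^bsup>|C \<pi>|\<^esup> + (\<Sum>\<sigma>\<noteq>\<pi>. (1-p)\<^bsup>|C \<sigma> - C \<pi>|\<^esup> - (1-p)\<^bsup>|C \<sigma>|\<^esup>)\<close>; the factor \<open>1/\<lambda>\<close> in the increments of the
  solution of Stein's equation cancels the sum of the \<open>n!\<close> contributions.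

  A covering permutation arises by inserting a value \<open>v\<close> at a position \<open>k\<close>, so there are \<open>(n+1)\<^sup>2\<close>
  pairs \<open>(k, v)\<close>. If inserting at two different pairs, into \<open>\<pi>\<close> and into \<open>\<sigma>\<close>, gives the same
  permutation, then the first pair is adjacent to an entry of \<open>\<sigma>\<close>, which leaves at most \<open>4 n\<close>
  pairs. Hence \<open>C \<sigma> - C \<pi>\<close> has at least \<open>(n+1)\<^sup>2 - 8 n\<close> elements for \<open>\<sigma> \<noteq> \<pi>\<close>. As every permutation in
  \<open>S\<^bsub>n+1\<^esub>\<close> covers at most \<open>n+1\<close> others, the sum is at most
  \<open>(1-p)\<^bsup>(n+1)\<^sup>2 - 8 n\<^esup> p (n+1)\<^sup>3\<close>, which tends to \<open>0\<close> for \<open>p \<ge> (1+\<epsilon>) log n / n\<^sup>2\<close>.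
\<close>

section \<open>Stein's equation for the Poisson distribution\<close>

lemma pmf_poisson_Suc:
  assumes "r > 0"
  shows "(real k + 1) * pmf (poisson_pmf r) (Suc k) = r * pmf (poisson_pmf r) k"
proof -
  have "c * (r * x / (c * f) * e) = r * (x / f * e)" if "c \<noteq> 0" for c x e f :: real
    using that by simp
  from this[of "real k + 1" "r ^ k" "fact k" "exp (- r)"] show ?thesis
    using assms by (simp add: add.commute)
qed

text \<open>The recursion \<open>pmf_poisson_Suc\<close> turns \<open>r\<close> times each summand
  into \<open>Suc i\<close> times the next one, and \<open>Suc i\<close> is at most
  \<open>Suc k\<close>. Together with the tail estimate this settles the signs in the increments of
  Stein's solution.\<close>

lemma poisson_head_ratio:
  assumes "r > 0"
  shows "r * measure_pmf.prob (poisson_pmf r) {..<Suc k}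
           \<le> real (Suc k) * measure_pmf.prob (poisson_pmf r) {..Suc k}"
proof -
  let ?P = "poisson_pmf r"
  have "r * measure_pmf.prob ?P {..<Suc k} = (\<Sum>i\<le>k. real (Suc i) * pmf ?P (Suc i))"
    using pmf_poisson_Suc[OF assms]
    by (simp add: measure_measure_pmf_finite lessThan_Suc_atMost sum_distrib_left add.commute)
  also have "\<dots> \<le> (\<Sum>i\<le>k. real (Suc k) * pmf ?P (Suc i))"
    by (intro sum_mono mult_right_mono) auto
  also have "\<dots> = real (Suc k) * (\<Sum>i\<in>Suc ` {..k}. pmf ?P i)"
    by (simp add: sum_distrib_left sum.reindex)
  also have "\<dots> \<le> real (Suc k) * (\<Sum>i\<le>Suc k. pmf ?P i)"
    by (intro mult_left_mono sum_mono2) auto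
  finally show ?thesis
    by (simp add: measure_measure_pmf_finite)
qed

lemma pmf_nat_tail_sums:
  fixes P :: "nat pmf"
  shows "(\<lambda>i. pmf P (i + m)) sums measure_pmf.prob P {m..}"
proof -
  have "(\<lambda>i. measure_pmf.prob P {i + m}) sums measure_pmf.prob P (\<Union>i. {i + m})"
    by (intro measure_pmf.finite_measure_UNION) (auto simp: disjoint_family_on_def)
  moreover have "(\<Union>i. {i + m}) = {m..}"
    by (auto simp: le_iff_add add.commute)
  ultimately show ?thesis
    by (simp add: measure_pmf_single)
qed

lemma poisson_tail_ratio:
  assumes "r > 0"
  shows "real k * measure_pmf.prob (poisson_pmf r) {Suc k..}
           \<le> r * measure_pmf.prob (poisson_pmf r) {k..}"
proof (rule sums_le)
  let ?P = "poisson_pmf r"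
  show "(\<lambda>i. real k * pmf ?P (i + Suc k)) sums (real k * measure_pmf.prob ?P {Suc k..})"
    by (intro sums_mult pmf_nat_tail_sums)
  show "(\<lambda>i. r * pmf ?P (i + k)) sums (r * measure_pmf.prob ?P {k..})"
    by (intro sums_mult pmf_nat_tail_sums)
  show "real k * pmf ?P (i + Suc k) \<le> r * pmf ?P (i + k)" for i
  proof -
    have "real k * pmf ?P (i + Suc k) \<le> (real (i + k) + 1) * pmf ?P (Suc (i + k))"
      by (auto intro!: mult_right_mono)
    then show ?thesis
      using pmf_poisson_Suc[OF assms, of "i + k"] by simp
  qed
qed

text \<open>The numerator is the sum over \<open>i \<le> m\<close> of
  \<open>indicator A i - P A\<close>, weighted by the Poisson probabilities; this comes from solving
  Stein's recursion upwards from \<open>0\<close>. The value at \<open>0\<close> is a convention,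
  and the Lipschitz bounds below start at \<open>1\<close>.\<close>

definition stein_solution :: "real \<Rightarrow> nat set \<Rightarrow> nat \<Rightarrow> real" where
  "stein_solution r A k =
     (let P = measure_pmf.prob (poisson_pmf r)
      in case k of 0 \<Rightarrow> 0
         | Suc m \<Rightarrow> (P (A \<inter> {..m}) - P A * P {..m}) / (r * pmf (poisson_pmf r) m))"

lemma prob_Int_atMost_Suc:
  fixes P :: "nat pmf"
  shows "measure_pmf.prob P (A \<inter> {..Suc m})
           = measure_pmf.prob P (A \<inter> {..m}) + indicator A (Suc m) * pmf P (Suc m)"
proof (cases "Suc m \<in> A")
  case True
  have "A \<inter> {..Suc m} = (A \<inter> {..m}) \<union> {Suc m}"
    using True by (auto simp: le_Suc_eq)
  then show ?thesis
    using True by (subst (1) \<open>A \<inter> {..Suc m} = _\<close>, subst measure_pmf.finite_measure_Union)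
      (auto simp: measure_pmf_single)
next
  case False
  then have "A \<inter> {..Suc m} = A \<inter> {..m}"
    by (auto simp: le_Suc_eq)
  then show ?thesis
    using False by simp
qed

text \<open>For \<open>k = Suc m\<close>, the Poisson recursion gives both terms on the left the
  denominator \<open>pmf (poisson_pmf r) k\<close>, and their numerators differ by the contribution
  of \<open>k\<close> alone.\<close>

lemma stein_equation:
  assumes "r > 0"
  shows "r * stein_solution r A (Suc k) - real k * stein_solution r A k
           = indicator A k - measure_pmf.prob (poisson_pmf r) A"
proof -
  let ?P = "measure_pmf.prob (poisson_pmf r)" and ?f = "pmf (poisson_pmf r)"
  have f_pos: "?f i > 0" for i
    using assms by simp
  show ?thesis
  proof (cases k)
    case 0
    have "?P (A \<inter> {..0}) = indicator A 0 * ?f 0"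
      by (cases "0 \<in> A") (auto simp: measure_pmf_single)
    moreover have "?P {..0} = ?f 0"
      by (simp add: measure_pmf_single)
    ultimately show ?thesis
      using 0 assms f_pos[of 0] by (simp add: stein_solution_def Let_def field_simps del: pmf_poisson)
  next
    case (Suc m)
    let ?a = "?P (A \<inter> {..m})" and ?F = "?P {..m}" and ?i = "indicator A (Suc m) :: real"
    have U: "?P (A \<inter> {..Suc m}) = ?a + ?i * ?f (Suc m)" "?P {..Suc m} = ?F + ?f (Suc m)"
      using prob_Int_atMost_Suc[of "poisson_pmf r" A m] prob_Int_atMost_Suc[of "poisson_pmf r" UNIV m]
      by simp_all
    have r: "r * ?f m = real (Suc m) * ?f (Suc m)"
      using pmf_poisson_Suc[OF assms, of m] by (simp add: add.commute)
    have "real k * stein_solution r A k = (?a - ?P A * ?F) / ?f (Suc m)"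
      using Suc by (simp add: stein_solution_def Let_def r del: pmf_poisson of_nat_Suc)
    moreover have "r * stein_solution r A (Suc k)
        = (?a + ?i * ?f (Suc m) - ?P A * (?F + ?f (Suc m))) / ?f (Suc m)"
      using Suc assms by (simp add: stein_solution_def Let_def U del: pmf_poisson)
    ultimately show ?thesis
      using f_pos[of "Suc m"] Suc
      by (simp only: diff_divide_distrib[symmetric]) (simp add: field_simps del: pmf_poisson)
  qed
qed

text \<open>The increment is linear in the masses of \<open>A\<close> below, at and above
  \<open>Suc m\<close>. The tail estimate makes the coefficient of the mass below nonpositive, the
  head estimate that of the mass above. Only the point \<open>Suc m\<close> itself can contribute
  positively, and it gives at most \<open>1 / r\<close>.\<close>

lemma stein_solution_increment_le:
  assumes "r > 0"
  shows "stein_solution r A (Suc (Suc m)) - stein_solution r A (Suc m) \<le> 1 / r"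
proof -
  let ?P = "measure_pmf.prob (poisson_pmf r)" and ?f = "pmf (poisson_pmf r)"
  let ?k = "real (Suc m)"
  define U where "U = ?P (A \<inter> {..m})"
  define F where "F = ?P {..m}"
  define w where "w = ?f (Suc m)"
  define a where "a = (indicator A (Suc m) :: real)"
  \<comment> \<open>\<open>T\<close> is the mass of \<open>A\<close> above \<open>Suc m\<close>, so
    the mass of \<open>A\<close> is \<open>U + a * w + T\<close>.\<close>
  define T where "T = ?P A - U - a * w"
  have w: "w > 0"
    using assms by (simp add: w_def)
  have a: "0 \<le> a" "a \<le> 1"
    by (auto simp: a_def indicator_def)
  have U': "?P (A \<inter> {..Suc m}) = U + a * w" and F': "?P {..Suc m} = F + w"
    using prob_Int_atMost_Suc[of "poisson_pmf r" A m] prob_Int_atMost_Suc[of "poisson_pmf r" UNIV m]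
    by (simp_all add: U_def F_def w_def a_def)
  have "?P (A \<inter> {..Suc m}) \<le> ?P A"
    by (intro measure_pmf.finite_measure_mono) auto
  then have T: "T \<ge> 0"
    by (simp add: T_def U')
  have U: "U \<ge> 0"
    by (simp add: U_def)
  have rw: "r * ?f m = ?k * w"
    using pmf_poisson_Suc[OF assms, of m] by (simp add: w_def add.commute)
  have head: "r * F \<le> ?k * (F + w)"
    using poisson_head_ratio[OF assms, of m] by (simp only: lessThan_Suc_atMost F_def F')
  have "?P {Suc m..} = 1 - F" "?P {Suc (Suc m)..} = 1 - (F + w)"
    using measure_pmf.prob_compl[of "{..m}" "poisson_pmf r"]
      measure_pmf.prob_compl[of "{..Suc m}" "poisson_pmf r"]
    by (simp_all add: F_def F' Compl_atMost flip: Compl_eq_Diff_UNIV atLeast_Suc_greaterThan)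
  then have tail: "?k * (1 - (F + w)) \<le> r * (1 - F)"
    using poisson_tail_ratio[OF assms, of "Suc m"] by simp
  have g1: "stein_solution r A (Suc m) = (U - (U + a * w + T) * F) / (?k * w)"
    by (simp add: stein_solution_def Let_def rw T_def flip: U_def F_def del: of_nat_Suc)
  have g2: "stein_solution r A (Suc (Suc m)) = (U + a * w - (U + a * w + T) * (F + w)) / (r * w)"
    by (simp add: stein_solution_def Let_def rw T_def U' F' del: pmf_poisson flip: U_def F_def w_def)
  have "stein_solution r A (Suc (Suc m)) - stein_solution r A (Suc m)
      = (?k * (U + a * w - (U + a * w + T) * (F + w)) - r * (U - (U + a * w + T) * F)) / (r * ?k * w)"
    using assms w unfolding g1 g2 by (simp add: field_simps del: of_nat_Suc)
  also have "?k * (U + a * w - (U + a * w + T) * (F + w)) - r * (U - (U + a * w + T) * F)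
      = U * (?k * (1 - (F + w)) - r * (1 - F)) + T * (r * F - ?k * (F + w))
        + a * w * (?k + (r * F - ?k * (F + w)))"
    by (simp add: algebra_simps)
  also have "\<dots> \<le> 0 + 0 + w * ?k"
  proof (intro add_mono)
    have "a * w * (?k + (r * F - ?k * (F + w))) \<le> a * w * ?k"
      using a w head by (intro mult_left_mono) auto
    also have "\<dots> \<le> w * ?k"
      using a w by (intro mult_right_mono) auto
    finally show "a * w * (?k + (r * F - ?k * (F + w))) \<le> w * ?k" .
  qed (use U T head tail in \<open>auto intro!: mult_nonneg_nonpos\<close>)
  finally have "stein_solution r A (Suc (Suc m)) - stein_solution r A (Suc m)
      \<le> (0 + 0 + w * ?k) / (r * ?k * w)"
    using assms w by (simp add: divide_right_mono)
  also have "\<dots> = 1 / r"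
    using assms w by simp
  finally show ?thesis .
qed

text \<open>The numerators for \<open>A\<close> and \<open>- A\<close> add up to \<open>0\<close>.
  Thus the upper bound on increments, applied to \<open>- A\<close>, is also a lower bound for
  \<open>A\<close>.\<close>

lemma stein_solution_Compl:
  "stein_solution r (- A) k = - stein_solution r A k"
proof (cases k)
  case (Suc m)
  let ?P = "measure_pmf.prob (poisson_pmf r)"
  have total: "?P {..m} = ?P (A \<inter> {..m}) + ?P (- A \<inter> {..m})"
    by (subst measure_pmf.finite_measure_Union[symmetric]) (auto intro: arg_cong[where f = ?P])
  have compl: "?P (- A) = 1 - ?P A"
    using measure_pmf.prob_compl[of A "poisson_pmf r"] by (simp add: Compl_eq_Diff_UNIV)
  have "?P (- A \<inter> {..m}) - ?P (- A) * ?P {..m} = - (?P (A \<inter> {..m}) - ?P A * ?P {..m})"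
    unfolding total compl by (simp add: algebra_simps)
  then show ?thesis
    using Suc by (simp add: stein_solution_def Let_def del: pmf_poisson minus_diff_eq)
qed (simp add: stein_solution_def Let_def)

lemma stein_solution_Lipschitz:
  assumes "r > 0" "m \<ge> 1" "m \<le> k"
  shows "\<bar>stein_solution r A k - stein_solution r A m\<bar> \<le> (real k - real m) / r"
  using assms(3)
proof (induction k rule: dec_induct)
  case (step k)
  obtain l where l: "k = Suc l"
    using step.hyps assms(2) by (cases k) auto
  have "\<bar>stein_solution r A (Suc k) - stein_solution r A k\<bar> \<le> 1 / r"
    using stein_solution_increment_le[OF assms(1), of A l]
      stein_solution_increment_le[OF assms(1), of "- A" l]
    by (simp add: stein_solution_Compl l)
  with step.IH show ?case
    by (simp add: diff_divide_distrib add_divide_distrib)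
qed simp

lemma stein_solution_Lipschitz_abs:
  assumes "r > 0" "m \<ge> 1" "k \<ge> 1"
  shows "\<bar>stein_solution r A k - stein_solution r A m\<bar> \<le> \<bar>real k - real m\<bar> / r"
  using stein_solution_Lipschitz[OF assms(1), of m k A] stein_solution_Lipschitz[OF assms(1), of k m A]
    assms(2,3)
  by (cases "m \<le> k") (auto simp: abs_minus_commute)

section \<open>The Stein--Chen bound for families of sets avoided by a random set\<close>

lemma set_random_subset_pmf: "set_pmf (random_subset_pmf S q) \<subseteq> Pow S"
  by (auto simp: random_subset_pmf_def)

lemma finite_set_random_subset_pmf [simp]:
  "finite S \<Longrightarrow> finite (set_pmf (random_subset_pmf S q))"
  by (meson finite_Pow_iff finite_subset set_random_subset_pmf)

lemma random_subset_pmf_Un: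
  assumes "finite C" "finite D" "C \<inter> D = {}"
  shows "random_subset_pmf (C \<union> D) q
    = map_pmf (\<lambda>(A, B). A \<union> B) (pair_pmf (random_subset_pmf C q) (random_subset_pmf D q))"
proof -
  have "{x \<in> C \<union> D. if x \<in> C then f x else g x} = {x \<in> C. f x} \<union> {x \<in> D. g x}" for f g
    using assms(3) by auto
  then show ?thesis
    unfolding random_subset_pmf_def Pi_pmf_union[OF assms]
    by (simp only: map_pair[symmetric]) (simp add: pmf.map_comp o_def case_prod_unfold)
qed

text \<open>In terms of the independent coin flips the event is a box: each coordinate in
  \<open>C\<close> must be \<open>False\<close>, the others are free.\<close>

lemma prob_random_subset_avoids:
  assumes "finite S" "C \<subseteq> S" "0 \<le> q" "q \<le> 1"
  shows "measure_pmf.prob (random_subset_pmf S q) {A. A \<inter> C = {}} = (1 - q) ^ card C"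
proof -
  have "measure_pmf.prob (random_subset_pmf S q) {A. A \<inter> C = {}}
      = measure_pmf.prob (Pi_pmf S False (\<lambda>_. bernoulli_pmf q))
          (Pi S (\<lambda>x. if x \<in> C then {False} else UNIV))"
    using assms(2) unfolding random_subset_pmf_def measure_map_pmf
    by (intro arg_cong[where f = "measure_pmf.prob _"]) (auto simp: Pi_iff split: if_splits)
  also have "\<dots> = (\<Prod>x\<in>S. if x \<in> C then 1 - q else 1)"
    unfolding measure_Pi_pmf_Pi[OF assms(1)]
    using assms(3,4) by (intro prod.cong) (auto simp: measure_pmf_single)
  also have "\<dots> = (1 - q) ^ card C"
    using assms(1,2) by (simp add: prod.If_cases Int_absorb1)
  finally show ?thesis .
qed

lemma expectation_pair_pmf_mult:
  fixes f :: "'a \<Rightarrow> real" and g :: "'b \<Rightarrow> real"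
  assumes "finite (set_pmf P)" "finite (set_pmf Q)"
  shows "measure_pmf.expectation (pair_pmf P Q) (\<lambda>(x, y). f x * g y)
    = measure_pmf.expectation P f * measure_pmf.expectation Q g"
proof -
  have "measure_pmf.expectation (pair_pmf P Q) (\<lambda>(x, y). f x * g y)
      = (\<Sum>(x, y)\<in>set_pmf P \<times> set_pmf Q. (f x * pmf P x) * (g y * pmf Q y))"
    using assms by (subst integral_measure_pmf_real[of "set_pmf P \<times> set_pmf Q"])
      (auto simp: pmf_pair intro!: sum.cong)
  also have "\<dots> = (\<Sum>x\<in>set_pmf P. f x * pmf P x) * (\<Sum>y\<in>set_pmf Q. g y * pmf Q y)"
    by (simp add: sum_product sum.cartesian_product)
  finally show ?thesis
    using assms by (simp add: integral_measure_pmf_real[of "set_pmf P"]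
      integral_measure_pmf_real[of "set_pmf Q"])
qed

text \<open>\<open>A \<inter> C\<close> and \<open>A - C\<close> are independent, being random
  subsets of disjoint sets. This is the exact form of the coupling: given that \<open>A\<close>
  avoids \<open>C\<close>, it is distributed as \<open>A - C\<close>.\<close>

lemma expectation_avoids_mult:
  fixes f :: "'a set \<Rightarrow> real"
  assumes "finite S" "C \<subseteq> S" "0 \<le> q" "q \<le> 1"
  shows "measure_pmf.expectation (random_subset_pmf S q) (\<lambda>A. of_bool (A \<inter> C = {}) * f (A - C))
    = (1 - q) ^ card C * measure_pmf.expectation (random_subset_pmf S q) (\<lambda>A. f (A - C))"
proof -
  let ?P = "random_subset_pmf C q" and ?Q = "random_subset_pmf (S - C) q"
  have fin: "finite C" "finite (S - C)"
    using assms finite_subset by auto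
  have R: "random_subset_pmf S q = map_pmf (\<lambda>(A, B). A \<union> B) (pair_pmf ?P ?Q)"
    using random_subset_pmf_Un[OF fin] assms(2) by (simp add: Un_absorb1)
  have split: "measure_pmf.expectation (random_subset_pmf S q) (\<lambda>A. h (A \<inter> C) * f (A - C))
      = measure_pmf.expectation ?P h * measure_pmf.expectation ?Q f" for h :: "'a set \<Rightarrow> real"
  proof -
    have "measure_pmf.expectation (random_subset_pmf S q) (\<lambda>A. h (A \<inter> C) * f (A - C))
        = measure_pmf.expectation (pair_pmf ?P ?Q) (\<lambda>(A, B). h A * f B)"
      unfolding R integral_map_pmf
    proof (intro integral_cong_AE AE_pmfI; clarsimp)
      fix A B
      assume "A \<in> set_pmf ?P" "B \<in> set_pmf ?Q"
      then have "A \<subseteq> C" "B \<subseteq> S - C"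
        using set_random_subset_pmf by blast+
      then have "(A \<union> B) \<inter> C = A" "A \<union> B - C = B"
        by auto
      then show "h ((A \<union> B) \<inter> C) * f (A \<union> B - C) = h A * f B"
        by simp
    qed
    also have "\<dots> = measure_pmf.expectation ?P h * measure_pmf.expectation ?Q f"
      using fin by (intro expectation_pair_pmf_mult) auto
    finally show ?thesis .
  qed
  have "measure_pmf.expectation ?P (\<lambda>A. of_bool (A = {})) = measure_pmf.prob ?P {A. A \<inter> C = {}}"
  proof -
    have "measure_pmf.expectation ?P (\<lambda>A. of_bool (A = {}))
        = measure_pmf.expectation ?P (indicat_real {A. A \<inter> C = {}})"
      using set_random_subset_pmf[of C q]
      by (intro integral_cong_AE AE_pmfI) (auto simp: indicator_def)
    then show ?thesis
      by simp
  qed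
  then have "measure_pmf.expectation ?P (\<lambda>A. of_bool (A = {})) = (1 - q) ^ card C"
    using prob_random_subset_avoids[OF fin(1) subset_refl assms(3,4)] by simp
  then show ?thesis
    \<comment> \<open>The constant weight \<open>1\<close> identifies the expectation over random
      subsets of \<open>S - C\<close> with that of \<open>f (A - C)\<close>.\<close>
    using split[of "\<lambda>A. of_bool (A = {})"] split[of "\<lambda>_. 1"] by simp
qed

lemma d_TV_le:
  assumes "\<And>A. \<bar>measure_pmf.prob P A - measure_pmf.prob Q A\<bar> \<le> \<delta>"
  shows "d_TV P Q \<le> \<delta>"
  unfolding d_TV_def by (rule cSUP_least) (use assms in auto)

lemma d_TV_nonneg: "0 \<le> d_TV P Q"
proof -
  have "bdd_above (range (\<lambda>A. \<bar>measure_pmf.prob P A - measure_pmf.prob Q A\<bar>))"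
  proof (rule bdd_aboveI2)
    show "\<bar>measure_pmf.prob P A - measure_pmf.prob Q A\<bar> \<le> 1" for A
      using measure_pmf.prob_le_1[of P A] measure_pmf.prob_le_1[of Q A]
        measure_nonneg[of "measure_pmf P" A] measure_nonneg[of "measure_pmf Q" A] by linarith
  qed
  from cSUP_upper[OF UNIV_I this, of "{}"] show ?thesis
    by (simp add: d_TV_def)
qed

text \<open>Passing from \<open>A\<close> to \<open>A - C i\<close> can only create avoided sets. So
  \<open>W A + 1 - W (A - C i)\<close> is the indicator of \<open>i\<close> minus a sum of
  nonnegative terms, and its absolute value is at most the sum of both parts, whose expectation is
  computed exactly.\<close>

lemma stein_chen_avoidance:
  fixes C :: "'i \<Rightarrow> 'a set" and q :: real
  assumes fin: "finite S" "finite I" and C: "\<And>i. i \<in> I \<Longrightarrow> C i \<subseteq> S"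
    and q: "0 \<le> q" "q \<le> 1"
  defines "R \<equiv> random_subset_pmf S q"
    and "W \<equiv> \<lambda>A. card {i \<in> I. A \<inter> C i = {}}"
  assumes bound: "\<And>i. i \<in> I \<Longrightarrow> (1 - q) ^ card (C i)
      + (\<Sum>j\<in>I - {i}. (1 - q) ^ card (C j - C i) - (1 - q) ^ card (C j)) \<le> \<delta>"
    and \<delta>: "\<delta> \<ge> 0"
  shows "d_TV (map_pmf W R) (Po (measure_pmf.expectation R (\<lambda>A. real (W A)))) \<le> \<delta>"
proof -
  define X where "X = (\<lambda>i A. of_bool (A \<inter> C i = {}) :: real)"
  define r where "r = measure_pmf.expectation R (\<lambda>A. real (W A))"
  define \<pi> where "\<pi> = (\<lambda>i. (1 - q) ^ card (C i))"
  let ?E = "measure_pmf.expectation R"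
  have int [simp]: "integrable (measure_pmf R) f" for f :: "_ \<Rightarrow> real"
    using fin by (intro integrable_measure_pmf_finite) (simp add: R_def)
  have prob: "?E (\<lambda>A. of_bool (A \<inter> D = {})) = (1 - q) ^ card D" if "D \<subseteq> S" for D
  proof -
    have "(\<lambda>A. of_bool (A \<inter> D = {})) = indicat_real {A. A \<inter> D = {}}"
      by (auto simp: indicator_def)
    then show ?thesis
      using prob_random_subset_avoids[OF fin(1) that q] by (simp add: R_def)
  qed
  have W: "real (W A) = (\<Sum>i\<in>I. X i A)" for A
    using fin(2) by (simp add: W_def X_def sum_of_bool_eq Int_def)
  have r: "r = (\<Sum>i\<in>I. \<pi> i)"
    unfolding r_def W using prob[OF C] by (simp add: X_def \<pi>_def)
  have \<pi>: "0 \<le> \<pi> i" for i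
    using q by (simp add: \<pi>_def)
  show ?thesis
  proof (cases "r = 0")
    \<comment> \<open>Stein's solution divides by \<open>r\<close>. For \<open>r = 0\<close>, both
      laws are the point mass at \<open>0\<close>.\<close>
    case True
    have "AE A in measure_pmf R. real (W A) = 0"
      using True integral_nonneg_eq_0_iff_AE[of "measure_pmf R" "\<lambda>A. real (W A)"]
      by (simp add: r_def)
    then have "map_pmf W R = map_pmf (\<lambda>_. 0) R"
      by (intro map_pmf_cong) (auto simp: AE_measure_pmf_iff)
    then show ?thesis
      using True \<delta> unfolding r_def[symmetric] by (intro d_TV_le) (simp add: Po_def)
  next
    case False
    then have r_pos: "r > 0"
      using \<pi> unfolding r by (simp add: order_less_le sum_nonneg)
    have "\<bar>measure_pmf.prob (map_pmf W R) B - measure_pmf.prob (Po r) B\<bar> \<le> \<delta>" for B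
    proof -
      define g where "g = stein_solution r B"
      have stein: "r * g (Suc k) - real k * g k = indicator B k - measure_pmf.prob (Po r) B" for k
        using stein_equation[OF r_pos, of B k] r_pos by (simp add: g_def Po_def)
      \<comment> \<open>Where \<open>A\<close> avoids \<open>C i\<close>, \<open>A\<close> equals
        \<open>A - C i\<close>; writing the latter makes the two factors independent.\<close>
      have Wg: "real (W A) * g (W A) = (\<Sum>i\<in>I. of_bool (A \<inter> C i = {}) * g (W (A - C i)))" for A
        unfolding W sum_distrib_right X_def by (intro sum.cong) (auto simp: Diff_triv)
      have "(\<lambda>A. indicator B (W A)) = indicat_real (W -` B)"
        by (auto simp: indicator_def)
      then have "measure_pmf.prob (map_pmf W R) B - measure_pmf.prob (Po r) B
          = ?E (\<lambda>A. indicator B (W A) - measure_pmf.prob (Po r) B)"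
        by simp
      also have "\<dots> = ?E (\<lambda>A. r * g (Suc (W A)) - real (W A) * g (W A))"
        by (simp add: stein)
      also have "\<dots> = r * ?E (\<lambda>A. g (Suc (W A)))
          - (\<Sum>i\<in>I. ?E (\<lambda>A. of_bool (A \<inter> C i = {}) * g (W (A - C i))))"
        by (simp add: Wg)
      also have "(\<Sum>i\<in>I. ?E (\<lambda>A. of_bool (A \<inter> C i = {}) * g (W (A - C i))))
          = (\<Sum>i\<in>I. \<pi> i * ?E (\<lambda>A. g (W (A - C i))))"
        using expectation_avoids_mult[OF fin(1) C q, where f = "\<lambda>A. g (W A)"]
        by (intro sum.cong) (auto simp: R_def \<pi>_def)
      \<comment> \<open>Expanding \<open>r\<close> as the sum of the \<open>\<pi> i\<close> pairs
        each coupled term with its own copy of the uncoupled one.\<close>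
      also have "r * ?E (\<lambda>A. g (Suc (W A))) - \<dots>
          = (\<Sum>i\<in>I. \<pi> i * ?E (\<lambda>A. g (Suc (W A)) - g (W (A - C i))))"
        by (simp add: r sum_distrib_right sum_subtractf right_diff_distrib)
      finally have "\<bar>measure_pmf.prob (map_pmf W R) B - measure_pmf.prob (Po r) B\<bar>
          \<le> (\<Sum>i\<in>I. \<pi> i * \<bar>?E (\<lambda>A. g (Suc (W A)) - g (W (A - C i)))\<bar>)"
        using \<pi> by (auto intro!: order_trans[OF sum_abs] simp: abs_mult)
      also have "\<dots> \<le> (\<Sum>i\<in>I. \<pi> i * (\<delta> / r))"
      proof (intro sum_mono mult_left_mono \<pi>)
        fix i assume i: "i \<in> I"
        have "\<bar>?E (\<lambda>A. g (Suc (W A)) - g (W (A - C i)))\<bar>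
            \<le> ?E (\<lambda>A. \<bar>g (Suc (W A)) - g (W (A - C i))\<bar>)"
          by (rule integral_abs_bound)
        also have "\<dots> \<le> ?E (\<lambda>A. (X i A + (\<Sum>j\<in>I - {i}. X j (A - C i) - X j A)) / r)"
        proof (intro integral_mono int)
          fix A
          \<comment> \<open>The set \<open>C i\<close> is avoided by \<open>A - C i\<close>, which
            keeps the argument of \<open>g\<close> away from \<open>0\<close>.\<close>
          have "{j \<in> I. (A - C i) \<inter> C j = {}} \<noteq> {}"
            using i by auto
          then have "W (A - C i) \<ge> 1"
            using fin(2) by (simp add: W_def Suc_le_eq card_gt_0_iff)
          then have "\<bar>g (Suc (W A)) - g (W (A - C i))\<bar> \<le> \<bar>real (Suc (W A)) - real (W (A - C i))\<bar> / r"
            unfolding g_def by (intro stein_solution_Lipschitz_abs r_pos) auto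
          also have "real (Suc (W A)) - real (W (A - C i))
              = X i A - (\<Sum>j\<in>I - {i}. X j (A - C i) - X j A)"
          proof -
            have "X i (A - C i) = 1"
              by (auto simp: X_def)
            then show ?thesis
              using fin(2) i by (simp add: W sum.remove[OF fin(2) i] sum_subtractf)
          qed
          also have "\<bar>\<dots>\<bar> \<le> X i A + (\<Sum>j\<in>I - {i}. X j (A - C i) - X j A)"
          proof -
            have "0 \<le> X i A" "0 \<le> (\<Sum>j\<in>I - {i}. X j (A - C i) - X j A)"
              by (auto simp: X_def intro!: sum_nonneg)
            then show ?thesis
              by linarith
          qed
          finally show "\<bar>g (Suc (W A)) - g (W (A - C i))\<bar>
              \<le> (X i A + (\<Sum>j\<in>I - {i}. X j (A - C i) - X j A)) / r"
            using r_pos by (simp add: divide_right_mono)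
        qed
        also have "\<dots> = (?E (X i) + (\<Sum>j\<in>I - {i}. ?E (\<lambda>A. X j (A - C i)) - ?E (X j))) / r"
          by simp
        also have "\<dots> = (\<pi> i + (\<Sum>j\<in>I - {i}. (1 - q) ^ card (C j - C i) - (1 - q) ^ card (C j))) / r"
        proof -
          have "?E (\<lambda>A. X j (A - C i)) = (1 - q) ^ card (C j - C i)" if "j \<in> I" for j
          proof -
            have "(A - C i) \<inter> C j = A \<inter> (C j - C i)" for A
              by auto
            then show ?thesis
              using prob[of "C j - C i"] C[OF that] by (auto simp: X_def)
          qed
          moreover have "?E (X j) = (1 - q) ^ card (C j)" if "j \<in> I" for j
            using prob[OF C[OF that]] by (simp add: X_def)
          ultimately show ?thesis
            using i by (simp add: \<pi>_def)
        qed
        also have "\<dots> \<le> \<delta> / r"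
          using bound[OF i] r_pos by (simp add: \<pi>_def divide_right_mono)
        finally show "\<bar>?E (\<lambda>A. g (Suc (W A)) - g (W (A - C i)))\<bar> \<le> \<delta> / r" .
      qed
      \<comment> \<open>The weights \<open>\<pi> i\<close> sum to \<open>r\<close>, cancelling the
        Lipschitz factor \<open>1 / r\<close>.\<close>
      also have "\<dots> = \<delta>"
        using r_pos by (simp only: sum_distrib_right[symmetric] r[symmetric]) simp
      finally show ?thesis .
    qed
    then show ?thesis
      unfolding r_def[symmetric] by (rule d_TV_le)
  qed
qed

section \<open>Covering permutations\<close>

text \<open>The increasing map on the naturals whose range misses exactly \<open>v\<close>.\<close>

definition bump :: "nat \<Rightarrow> nat \<Rightarrow> nat" where
  "bump v x = (if v \<le> x then Suc x else x)"

definition unbump :: "nat \<Rightarrow> nat \<Rightarrow> nat" where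
  "unbump v x = (if v < x then x - 1 else x)"

text \<open>Positions count from \<open>0\<close>, whereas the entries of a permutation count from \<open>1\<close>.\<close>

definition insert_entry :: "nat \<Rightarrow> nat \<Rightarrow> nat list \<Rightarrow> nat list" where
  "insert_entry k v \<pi> = map (bump v) (take k \<pi>) @ v # map (bump v) (drop k \<pi>)"

definition delete_entry :: "nat \<Rightarrow> nat list \<Rightarrow> nat list" where
  "delete_entry k \<rho> = map (unbump (\<rho> ! k)) (take k \<rho> @ drop (Suc k) \<rho>)"

lemma unbump_bump [simp]: "unbump v (bump v x) = x"
  by (simp add: bump_def unbump_def)

lemma bump_less_iff [simp]: "bump v x < bump v y \<longleftrightarrow> x < y"
  by (auto simp: bump_def)

lemma inj_bump: "inj_on (bump v) A"
  by (rule inj_on_inverseI[where g = "unbump v"]) simp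

lemma bump_neq [simp]: "bump v x \<noteq> v" "v \<noteq> bump v x"
  by (simp_all add: bump_def)

lemma nth_insert_entry:
  assumes "k \<le> length \<pi>" "i \<le> length \<pi>"
  shows "insert_entry k v \<pi> ! i
    = (if i < k then bump v (\<pi> ! i) else if i = k then v else bump v (\<pi> ! (i - 1)))"
proof -
  have len: "length (map (bump v) (take k \<pi>)) = k"
    using assms(1) by simp
  consider "i < k" | "i = k" | j where "i = Suc (k + j)"
    by (metis less_iff_Suc_add linorder_neqE_nat)
  then show ?thesis
    using assms unfolding insert_entry_def nth_append len by cases simp_all
qed

lemma delete_insert_entry [simp]:
  assumes "k \<le> length \<pi>"
  shows "delete_entry k (insert_entry k v \<pi>) = \<pi>"
proof -
  have "insert_entry k v \<pi> ! k = v"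
    using nth_insert_entry[OF assms assms] by simp
  moreover have "take k (insert_entry k v \<pi>) @ drop (Suc k) (insert_entry k v \<pi>) = map (bump v) \<pi>"
    using assms by (simp add: insert_entry_def min_def flip: map_append)
  ultimately show ?thesis
    by (simp add: delete_entry_def o_def del: map_append)
qed

lemma SnD:
  assumes "\<pi> \<in> Sn n"
  shows "set \<pi> = {1..n}" "distinct \<pi>" "length \<pi> = n"
  using permutations_of_setD(1)[OF assms] permutations_of_setD(2)[OF assms]
    length_finite_permutations_of_set[OF assms] by simp_all

lemma bump_image:
  assumes "v \<in> {1..n + 1}"
  shows "bump v ` {1..n} = {1..n + 1} - {v}"
proof
  show "bump v ` {1..n} \<subseteq> {1..n + 1} - {v}"
    using assms by (auto simp: bump_def)
  show "{1..n + 1} - {v} \<subseteq> bump v ` {1..n}"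
  proof
    fix x assume "x \<in> {1..n + 1} - {v}"
    then have "x = bump v (unbump v x)" "unbump v x \<in> {1..n}"
      using assms by (auto simp: bump_def unbump_def)
    then show "x \<in> bump v ` {1..n}"
      by blast
  qed
qed

lemma insert_entry_in_Sn:
  assumes "\<pi> \<in> Sn n" "k \<le> n" "v \<in> {1..n + 1}"
  shows "insert_entry k v \<pi> \<in> Sn (n + 1)"
proof (rule permutations_of_setI)
  have eq: "map (bump v) (take k \<pi>) @ map (bump v) (drop k \<pi>) = map (bump v) \<pi>"
    by (simp flip: map_append)
  have "set (insert_entry k v \<pi>) = insert v (bump v ` set \<pi>)"
    unfolding insert_entry_def using arg_cong[OF eq, of set] by auto
  then show "set (insert_entry k v \<pi>) = {1..n + 1}"
    using bump_image[OF assms(3)] SnD[OF assms(1)] assms(3) by auto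
  have "distinct (map (bump v) \<pi>)"
    using SnD[OF assms(1)] by (simp add: distinct_map inj_bump)
  then have "distinct (map (bump v) (take k \<pi>) @ map (bump v) (drop k \<pi>))"
    unfolding eq .
  then show "distinct (insert_entry k v \<pi>)"
    unfolding insert_entry_def by auto
qed

text \<open>As soon as one entry is skipped, the remaining lengths agree and force equality. This
  locates the entry to be inserted in a covering permutation.\<close>

lemma subseq_remove_one:
  assumes "subseq xs ys" "length ys = Suc (length xs)"
  shows "\<exists>us v ws. ys = us @ v # ws \<and> xs = us @ ws"
  using assms
proof (induction rule: list_emb.induct)
  case (list_emb_Nil ys)
  then show ?case
    by (auto simp: length_Suc_conv)
next
  case (list_emb_Cons xs ys y)
  from list_emb_Cons.prems have "length xs = length ys"
    by simp
  then have "y # ys = [] @ y # ys \<and> xs = [] @ ys"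
    using subseq_same_length[OF list_emb_Cons.hyps] by simp
  then show ?case
    by blast
next
  case (list_emb_Cons2 x y xs ys)
  from list_emb_Cons2.prems have "length ys = Suc (length xs)"
    by simp
  from list_emb_Cons2.IH[OF this] obtain us v ws where "ys = us @ v # ws" "xs = us @ ws"
    by blast
  then have "y # ys = (y # us) @ v # ws" "x # xs = (y # us) @ ws"
    using list_emb_Cons2.hyps by simp_all
  then show ?case
    by blast
qed

text \<open>An entry is determined by its rank, the number of smaller entries, and an order
  isomorphism preserves ranks.\<close>

lemma order_isomorphic_unique:
  assumes "order_isomorphic xs ys" "distinct xs" "distinct ys" "set xs = set ys"
  shows "xs = ys"
proof (rule nth_equalityI)
  show len: "length xs = length ys"
    using assms by (simp add: order_isomorphic_def)
  fix i assume i: "i < length xs"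
  have rank: "card {y \<in> set zs. y < zs ! i} = card {j. j < length zs \<and> zs ! j < zs ! i}"
    if "distinct zs" for zs :: "nat list"
  proof -
    have "{y \<in> set zs. y < zs ! i} = (!) zs ` {j. j < length zs \<and> zs ! j < zs ! i}"
      by (auto simp: in_set_conv_nth)
    moreover have "inj_on ((!) zs) {j. j < length zs \<and> zs ! j < zs ! i}"
      using that by (auto simp: inj_on_def nth_eq_iff_index_eq)
    ultimately show ?thesis
      by (simp add: card_image)
  qed
  have "{j. j < length xs \<and> xs ! j < xs ! i} = {j. j < length ys \<and> ys ! j < ys ! i}"
    using assms(1) i by (auto simp: order_isomorphic_def)
  then have card_eq: "card {y \<in> set xs. y < xs ! i} = card {y \<in> set xs. y < ys ! i}"
    using rank[OF assms(2)] rank[OF assms(3)] assms(4) by simp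
  have mono: "card {y \<in> set xs. y < a} < card {y \<in> set xs. y < b}" if "a < b" "a \<in> set xs" for a b
    using that by (intro psubset_card_mono) auto
  have mem: "xs ! i \<in> set xs" "ys ! i \<in> set xs"
    using i nth_mem[of i ys] unfolding assms(4)[symmetric] len[symmetric] by simp_all
  show "xs ! i = ys ! i"
  proof (rule ccontr)
    assume "xs ! i \<noteq> ys ! i"
    then consider "xs ! i < ys ! i" | "ys ! i < xs ! i"
      by linarith
    then show False
      using card_eq mono[OF _ mem(1), of "ys ! i"] mono[OF _ mem(2), of "xs ! i"]
      by cases linarith+
  qed
qed

text \<open>A subsequence of length \<open>n\<close> omits a single value \<open>v\<close>. It has
  the same entries as \<open>map (bump v) \<pi>\<close> and the same relative order, hence equals
  it.\<close>

lemma covers_iff_insert_entry: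
  assumes "\<pi> \<in> Sn n" "\<rho> \<in> Sn (n + 1)"
  shows "covers \<rho> \<pi> \<longleftrightarrow> (\<exists>k\<le>n. \<exists>v\<in>{1..n + 1}. \<rho> = insert_entry k v \<pi>)"
proof
  assume "covers \<rho> \<pi>"
  then obtain \<sigma> where \<sigma>: "subseq \<sigma> \<rho>" "order_isomorphic \<sigma> \<pi>"
    by (auto simp: covers_def)
  then have len: "length \<sigma> = n"
    using SnD[OF assms(1)] by (simp add: order_isomorphic_def)
  then obtain us v ws where split: "\<rho> = us @ v # ws" "\<sigma> = us @ ws"
    using subseq_remove_one[OF \<sigma>(1)] SnD[OF assms(2)] by auto
  have v: "v \<in> {1..n + 1}"
    using SnD(1)[OF assms(2)] split by auto
  have "set \<sigma> = {1..n + 1} - {v}" "distinct \<sigma>"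
    using SnD(1,2)[OF assms(2)] split by auto
  moreover have "set (map (bump v) \<pi>) = {1..n + 1} - {v}" "distinct (map (bump v) \<pi>)"
    using SnD[OF assms(1)] bump_image[OF v] by (auto simp: distinct_map inj_bump)
  moreover have "order_isomorphic \<sigma> (map (bump v) \<pi>)"
    using \<sigma>(2) by (auto simp: order_isomorphic_def)
  ultimately have "\<sigma> = map (bump v) \<pi>"
    by (intro order_isomorphic_unique) auto
  then have "map (bump v) \<pi> = us @ ws"
    using split by simp
  then have "\<rho> = insert_entry (length us) v \<pi>"
    unfolding insert_entry_def split(1) take_map[symmetric] drop_map[symmetric] by simp
  moreover have "length us \<le> n"
    using len split by simp
  ultimately show "\<exists>k\<le>n. \<exists>v\<in>{1..n + 1}. \<rho> = insert_entry k v \<pi>"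
    using v by blast
next
  assume "\<exists>k\<le>n. \<exists>v\<in>{1..n + 1}. \<rho> = insert_entry k v \<pi>"
  then obtain k v where \<rho>: "\<rho> = insert_entry k v \<pi>"
    by blast
  have "subseq (map (bump v) (take k \<pi>) @ map (bump v) (drop k \<pi>)) \<rho>"
    unfolding \<rho> insert_entry_def by (intro list_emb_append_mono) auto
  then have "subseq (map (bump v) \<pi>) \<rho>"
    by (simp flip: map_append)
  moreover have "order_isomorphic (map (bump v) \<pi>) \<pi>"
    by (simp add: order_isomorphic_def)
  ultimately show "covers \<rho> \<pi>"
    by (auto simp: covers_def)
qed

text \<open>
  The pairs \<open>(k, v)\<close> such that inserting \<open>v\<close> at position \<open>k\<close> puts it next to an entry of \<open>\<pi>\<close> both
  horizontally and vertically.
\<close>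

definition adjacent_cells :: "nat list \<Rightarrow> (nat \<times> nat) set" where
  "adjacent_cells \<pi> = (\<Union>i<length \<pi>. {i, Suc i} \<times> {\<pi> ! i, Suc (\<pi> ! i)})"

lemma finite_adjacent_cells [simp]: "finite (adjacent_cells \<pi>)"
  by (simp add: adjacent_cells_def)

lemma card_adjacent_cells: "card (adjacent_cells \<pi>) \<le> 4 * length \<pi>"
proof -
  have "card (adjacent_cells \<pi>) \<le> (\<Sum>i<length \<pi>. card ({i, Suc i} \<times> {\<pi> ! i, Suc (\<pi> ! i)}))"
    unfolding adjacent_cells_def by (rule card_UN_le) simp
  also have "\<dots> = 4 * length \<pi>"
    by (simp add: card_cartesian_product)
  finally show ?thesis .
qed

lemma insert_entry_collision:
  assumes "insert_entry k v \<pi> = insert_entry l w \<sigma>" "(k, v) \<noteq> (l, w)"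
    and "length \<pi> = n" "length \<sigma> = n" "k \<le> n" "l \<le> n"
  shows "(k, v) \<in> adjacent_cells \<sigma>"
proof -
  \<comment> \<open>The entry \<open>v\<close> survives the deletion of \<open>w\<close>, moving by at most one position and one value.\<close>
  have v: "v = insert_entry l w \<sigma> ! k"
    using nth_insert_entry[of k \<pi> k v] assms by simp
  consider "k < l" | "l < k" | "k = l"
    by linarith
  then show ?thesis
  proof cases
    case 1
    then have "v = bump w (\<sigma> ! k)" "k < length \<sigma>"
      using v nth_insert_entry[of l \<sigma> k w] assms by simp_all
    then show ?thesis
      by (auto simp: adjacent_cells_def bump_def split: if_splits)
  next
    \<comment> \<open>To the right of the inserted \<open>w\<close>, position \<open>k\<close> holds
      entry \<open>k - 1\<close> of \<open>\<sigma>\<close>.\<close>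
    case 2
    then have "v = bump w (\<sigma> ! (k - 1))" "k - 1 < length \<sigma>" "k = Suc (k - 1)"
      using v nth_insert_entry[of l \<sigma> k w] assms by simp_all
    then have "(k, v) \<in> {k - 1, Suc (k - 1)} \<times> {\<sigma> ! (k - 1), Suc (\<sigma> ! (k - 1))}"
      by (auto simp: bump_def)
    then show ?thesis
      using \<open>k - 1 < length \<sigma>\<close> unfolding adjacent_cells_def by blast
  \<comment> \<open>At equal positions the inserted values coincide too, contradicting that the
    pairs differ.\<close>
  next
    case 3
    then show ?thesis
      using v nth_insert_entry[of l \<sigma> k w] assms by simp
  qed
qed

section \<open>Counting covering permutations and their overlaps\<close>

definition coverers :: "nat \<Rightarrow> nat list \<Rightarrow> nat list set" where
  "coverers n \<pi> = {\<rho> \<in> Sn (n + 1). covers \<rho> \<pi>}"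

lemma coverers_eq_image:
  assumes "\<pi> \<in> Sn n"
  shows "coverers n \<pi> = (\<lambda>(k, v). insert_entry k v \<pi>) ` ({..n} \<times> {1..n + 1})"
proof
  show "coverers n \<pi> \<subseteq> (\<lambda>(k, v). insert_entry k v \<pi>) ` ({..n} \<times> {1..n + 1})"
  proof
    fix \<rho> assume "\<rho> \<in> coverers n \<pi>"
    then obtain k v where "k \<le> n" "v \<in> {1..n + 1}" "\<rho> = insert_entry k v \<pi>"
      using covers_iff_insert_entry[OF assms, of \<rho>] unfolding coverers_def by blast
    then show "\<rho> \<in> (\<lambda>(k, v). insert_entry k v \<pi>) ` ({..n} \<times> {1..n + 1})"
      by (intro image_eqI[of _ _ "(k, v)"]) auto
  qed
  show "(\<lambda>(k, v). insert_entry k v \<pi>) ` ({..n} \<times> {1..n + 1}) \<subseteq> coverers n \<pi>"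
  proof
    fix \<rho> assume "\<rho> \<in> (\<lambda>(k, v). insert_entry k v \<pi>) ` ({..n} \<times> {1..n + 1})"
    then obtain k v where kv: "k \<le> n" "v \<in> {1..n + 1}" "\<rho> = insert_entry k v \<pi>"
      by (elim imageE SigmaE) simp
    then have "\<rho> \<in> Sn (n + 1)"
      using insert_entry_in_Sn[OF assms] by simp
    then show "\<rho> \<in> coverers n \<pi>"
      using covers_iff_insert_entry[OF assms] kv unfolding coverers_def by blast
  qed
qed

lemma finite_coverers [simp]: "finite (coverers n \<pi>)"
  by (simp add: coverers_def)

lemma card_coverers_le:
  assumes "\<pi> \<in> Sn n"
  shows "card (coverers n \<pi>) \<le> (n + 1)\<^sup>2"
proof -
  have "card (coverers n \<pi>) \<le> card ({..n} \<times> {1..n + 1})"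
    unfolding coverers_eq_image[OF assms] by (rule card_image_le) simp
  then show ?thesis
    by (simp add: card_cartesian_product power2_eq_square)
qed

text \<open>Discarding the cells adjacent to \<open>\<sigma>\<close> makes insertion into
  \<open>\<sigma>\<close> injective. Discarding those adjacent to \<open>\<pi>\<close> excludes
  every result that also covers \<open>\<pi>\<close> through a different pair; through the same
  pair, deletion would give \<open>\<sigma> = \<pi>\<close>. The subtraction truncates at
  \<open>0\<close> for small \<open>n\<close>.\<close>

lemma card_coverers_diff_ge:
  assumes "\<pi> \<in> Sn n" "\<sigma> \<in> Sn n" "\<pi> \<noteq> \<sigma>"
  shows "(n + 1)\<^sup>2 - 8 * n \<le> card (coverers n \<sigma> - coverers n \<pi>)"
proof -
  let ?ins = "\<lambda>(k, v). insert_entry k v \<sigma>"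
  let ?G = "{..n} \<times> {1..n + 1}"
  let ?G' = "?G - (adjacent_cells \<sigma> \<union> adjacent_cells \<pi>)"
  note len = SnD(3)[OF assms(1)] SnD(3)[OF assms(2)]
  have "inj_on ?ins ?G'"
    using insert_entry_collision[of _ _ \<sigma> _ _ \<sigma> n] len by (auto simp: inj_on_def)
  then have "card ?G' = card (?ins ` ?G')"
    by (simp add: card_image)
  also have "\<dots> \<le> card (coverers n \<sigma> - coverers n \<pi>)"
  proof (intro card_mono subsetI)
    fix \<rho> assume "\<rho> \<in> ?ins ` ?G'"
    then obtain x where x: "x \<in> ?G'" "\<rho> = ?ins x"
      by blast
    obtain k v where "x = (k, v)"
      by fastforce
    with x have kv: "(k, v) \<in> ?G'" "\<rho> = insert_entry k v \<sigma>"
      by simp_all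
    have "\<rho> \<notin> coverers n \<pi>"
    proof
      assume "\<rho> \<in> coverers n \<pi>"
      then obtain l w where lw: "l \<le> n" "\<rho> = insert_entry l w \<pi>"
        unfolding coverers_eq_image[OF assms(1)] by auto
      show False
      proof (cases "(k, v) = (l, w)")
        case True
        then have "delete_entry k (insert_entry k v \<sigma>) = delete_entry k (insert_entry k v \<pi>)"
          using kv lw by simp
        then show False
          using kv len assms(3) by simp
      next
        case False
        then show False
          using insert_entry_collision[of k v \<sigma> l w \<pi> n] kv lw len by auto
      qed
    qed
    then show "\<rho> \<in> coverers n \<sigma> - coverers n \<pi>"
      using kv unfolding coverers_eq_image[OF assms(2)] by auto
  qed simp
  finally have "card ?G' \<le> card (coverers n \<sigma> - coverers n \<pi>)" .
  moreover have "card ?G - card (adjacent_cells \<sigma> \<union> adjacent_cells \<pi>) \<le> card ?G'"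
    by (intro diff_card_le_card_Diff) simp
  moreover have "card (adjacent_cells \<sigma> \<union> adjacent_cells \<pi>) \<le> 8 * n"
    using card_Un_le[of "adjacent_cells \<sigma>" "adjacent_cells \<pi>"]
      card_adjacent_cells[of \<sigma>] card_adjacent_cells[of \<pi>] len by simp
  moreover have "card ?G = (n + 1)\<^sup>2"
    by (simp add: card_cartesian_product power2_eq_square)
  ultimately show ?thesis
    by linarith
qed

text \<open>Only injectivity of insertion is at stake here, so only the cells adjacent to
  \<open>\<pi>\<close> are discarded.\<close>

lemma card_coverers_ge:
  assumes "\<pi> \<in> Sn n"
  shows "(n + 1)\<^sup>2 - 4 * n \<le> card (coverers n \<pi>)"
proof -
  let ?ins = "\<lambda>(k, v). insert_entry k v \<pi>"
  let ?G = "{..n} \<times> {1..n + 1}"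
  have "inj_on ?ins (?G - adjacent_cells \<pi>)"
    using insert_entry_collision[of _ _ \<pi> _ _ \<pi> n] SnD(3)[OF assms] by (auto simp: inj_on_def)
  then have "card (?G - adjacent_cells \<pi>) = card (?ins ` (?G - adjacent_cells \<pi>))"
    by (simp add: card_image)
  also have "\<dots> \<le> card (coverers n \<pi>)"
    unfolding coverers_eq_image[OF assms] by (intro card_mono) auto
  finally have "card ?G - card (adjacent_cells \<pi>) \<le> card (coverers n \<pi>)"
    using diff_card_le_card_Diff[of "adjacent_cells \<pi>" ?G] by simp
  then show ?thesis
    using card_adjacent_cells[of \<pi>] SnD(3)[OF assms]
    by (simp add: card_cartesian_product power2_eq_square)
qed

text \<open>A covered permutation is recovered from \<open>\<rho>\<close> by the position of the
  deleted entry.\<close>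

lemma card_covered_le: "card {\<pi> \<in> Sn n. \<rho> \<in> coverers n \<pi>} \<le> n + 1"
proof -
  have "{\<pi> \<in> Sn n. \<rho> \<in> coverers n \<pi>} \<subseteq> (\<lambda>k. delete_entry k \<rho>) ` {..n}"
  proof
    fix \<pi> assume "\<pi> \<in> {\<pi> \<in> Sn n. \<rho> \<in> coverers n \<pi>}"
    then have "\<pi> \<in> Sn n" "\<rho> \<in> coverers n \<pi>"
      by auto
    moreover from this obtain k v where "k \<le> n" "\<rho> = insert_entry k v \<pi>"
      by (auto simp: coverers_eq_image)
    ultimately have "\<pi> = delete_entry k \<rho>"
      using SnD(3)[of \<pi> n] by simp
    then show "\<pi> \<in> (\<lambda>k. delete_entry k \<rho>) ` {..n}"
      using \<open>k \<le> n\<close> by blast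
  qed
  then have "card {\<pi> \<in> Sn n. \<rho> \<in> coverers n \<pi>} \<le> card {..n}"
    by (rule surj_card_le[OF finite_atMost])
  then show ?thesis
    by simp
qed

text \<open>Double counting of pairs \<open>(\<sigma>, \<rho>)\<close> in which
  \<open>\<rho>\<close> covers both \<open>\<sigma>\<close> and \<open>\<pi>\<close>.\<close>

lemma sum_card_coverers_Int_le:
  assumes "\<pi> \<in> Sn n"
  shows "(\<Sum>\<sigma>\<in>Sn n. card (coverers n \<sigma> \<inter> coverers n \<pi>)) \<le> (n + 1) ^ 3"
proof -
  have "(\<Sum>\<sigma>\<in>Sn n. card (coverers n \<sigma> \<inter> coverers n \<pi>))
      = (\<Sum>\<sigma>\<in>Sn n. \<Sum>\<rho>\<in>coverers n \<pi>. of_bool (\<rho> \<in> coverers n \<sigma>))"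
    by (simp add: Int_def conj_commute)
  also have "\<dots> = (\<Sum>\<rho>\<in>coverers n \<pi>. card {\<sigma> \<in> Sn n. \<rho> \<in> coverers n \<sigma>})"
    by (subst sum.swap) (simp add: Int_def)
  also have "\<dots> \<le> (\<Sum>\<rho>\<in>coverers n \<pi>. n + 1)"
    by (intro sum_mono card_covered_le)
  also have "\<dots> \<le> (n + 1)\<^sup>2 * (n + 1)"
    using card_coverers_le[OF assms] by (simp only: sum_constant) (intro mult_right_mono, auto)
  finally show ?thesis
    by (simp add: power3_eq_cube power2_eq_square)
qed

section \<open>The total variation bound for the number of uncovered permutations\<close>

text \<open>Factor out \<open>(1 - q) ^ a\<close> and apply Bernoulli's inequality to
  \<open>1 - (1 - q) ^ m\<close>.\<close>

lemma power_minus_power_le: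
  fixes q :: real
  assumes "0 \<le> q" "q \<le> 1" "M \<le> a"
  shows "(1 - q) ^ a - (1 - q) ^ (a + m) \<le> (1 - q) ^ M * (q * real m)"
proof -
  have "1 - q * real m \<le> (1 - q) ^ m"
    using Bernoulli_inequality[of "- q" m] assms by (simp add: mult.commute)
  then have "(1 - q) ^ a * (1 - (1 - q) ^ m) \<le> (1 - q) ^ M * (q * real m)"
    using assms by (intro mult_mono power_decreasing) (auto simp: power_le_one)
  then show ?thesis
    by (simp add: power_add right_diff_distrib)
qed

lemma d_TV_num_uncovered_le:
  fixes q :: real and n :: nat
  assumes q: "0 \<le> q" "q \<le> 1"
  defines "R \<equiv> random_subset_pmf (Sn (n + 1)) q"
  shows "d_TV (map_pmf (num_uncovered n) R) (Po (measure_pmf.expectation R (\<lambda>A. real (num_uncovered n A))))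
    \<le> (1 - q) ^ ((n + 1)\<^sup>2 - 8 * n) * (1 + q * (real n + 1) ^ 3)"
proof -
  let ?C = "coverers n" and ?M = "(n + 1)\<^sup>2 - 8 * n"
  let ?W = "\<lambda>A. card {\<pi> \<in> Sn n. A \<inter> ?C \<pi> = {}}"
  have W: "num_uncovered n A = ?W A" if "A \<in> set_pmf R" for A
    using that set_random_subset_pmf[of "Sn (n + 1)" q] unfolding num_uncovered_def coverers_def R_def
    by (intro arg_cong[where f = card]) blast
  have "map_pmf (num_uncovered n) R = map_pmf ?W R"
    using W by (intro map_pmf_cong) auto
  moreover have "measure_pmf.expectation R (\<lambda>A. real (num_uncovered n A))
      = measure_pmf.expectation R (\<lambda>A. real (?W A))"
    using W by (intro integral_cong_AE AE_pmfI) auto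
  moreover have "d_TV (map_pmf ?W R) (Po (measure_pmf.expectation R (\<lambda>A. real (?W A))))
      \<le> (1 - q) ^ ?M * (1 + q * (real n + 1) ^ 3)"
    unfolding R_def
  proof (rule stein_chen_avoidance)
    fix \<pi> assume \<pi>: "\<pi> \<in> Sn n"
    have "(1 - q) ^ card (?C \<pi>) \<le> (1 - q) ^ ?M"
      using card_coverers_ge[OF \<pi>] q by (intro power_decreasing) auto
    moreover have "(\<Sum>\<sigma>\<in>Sn n - {\<pi>}. (1 - q) ^ card (?C \<sigma> - ?C \<pi>) - (1 - q) ^ card (?C \<sigma>))
        \<le> (\<Sum>\<sigma>\<in>Sn n - {\<pi>}. (1 - q) ^ ?M * (q * real (card (?C \<sigma> \<inter> ?C \<pi>))))"
    proof (rule sum_mono)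
      fix \<sigma> assume \<sigma>: "\<sigma> \<in> Sn n - {\<pi>}"
      \<comment> \<open>The two exponents differ by the size of the overlap, which becomes the
        linear factor.\<close>
      have "card (?C \<sigma>) = card (?C \<sigma> - ?C \<pi>) + card (?C \<sigma> \<inter> ?C \<pi>)"
        by (subst card_Un_disjoint[symmetric]) (auto intro: arg_cong[where f = card])
      moreover have "?M \<le> card (?C \<sigma> - ?C \<pi>)"
        using card_coverers_diff_ge[OF \<pi>, of \<sigma>] \<sigma> by auto
      ultimately show "(1 - q) ^ card (?C \<sigma> - ?C \<pi>) - (1 - q) ^ card (?C \<sigma>)
          \<le> (1 - q) ^ ?M * (q * real (card (?C \<sigma> \<inter> ?C \<pi>)))"
        using power_minus_power_le[OF q] by simp
    qed
    moreover have "(\<Sum>\<sigma>\<in>Sn n - {\<pi>}. (1 - q) ^ ?M * (q * real (card (?C \<sigma> \<inter> ?C \<pi>))))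
        \<le> (1 - q) ^ ?M * (q * (real n + 1) ^ 3)"
    proof -
      have "(\<Sum>\<sigma>\<in>Sn n - {\<pi>}. card (?C \<sigma> \<inter> ?C \<pi>)) \<le> (\<Sum>\<sigma>\<in>Sn n. card (?C \<sigma> \<inter> ?C \<pi>))"
        by (intro sum_mono2) auto
      also have "\<dots> \<le> (n + 1) ^ 3"
        by (rule sum_card_coverers_Int_le[OF \<pi>])
      finally have "(\<Sum>\<sigma>\<in>Sn n - {\<pi>}. real (card (?C \<sigma> \<inter> ?C \<pi>))) \<le> real ((n + 1) ^ 3)"
        unfolding of_nat_sum[symmetric] of_nat_le_iff .
      then have "(\<Sum>\<sigma>\<in>Sn n - {\<pi>}. real (card (?C \<sigma> \<inter> ?C \<pi>))) \<le> (real n + 1) ^ 3"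
        by (simp add: add.commute)
      then show ?thesis
        unfolding sum_distrib_left[symmetric] using q by (intro mult_left_mono) auto
    qed
    ultimately show "(1 - q) ^ card (?C \<pi>)
        + (\<Sum>\<sigma>\<in>Sn n - {\<pi>}. (1 - q) ^ card (?C \<sigma> - ?C \<pi>) - (1 - q) ^ card (?C \<sigma>))
        \<le> (1 - q) ^ ?M * (1 + q * (real n + 1) ^ 3)"
      unfolding distrib_left by simp
  qed (use q in \<open>auto simp: coverers_def\<close>)
  ultimately show ?thesis
    by simp
qed

section \<open>Asymptotics at the threshold probability\<close>

text \<open>Reduces a large \<open>p\<close> to the threshold \<open>l\<close>. Since
  \<open>l * M \<ge> 1\<close>, the cross term in \<open>(1 + l * K) * (1 + (p - l) * M)\<close>
  absorbs \<open>(p - l) * K\<close>, and the second factor is at most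
  \<open>exp ((p - l) * M)\<close>.\<close>

lemma exp_minus_mult_affine_antimono:
  fixes l p M K :: real
  assumes "0 \<le> l" "l \<le> p" "1 \<le> l * M" "0 \<le> M" "0 \<le> K"
  shows "exp (- (p * M)) * (1 + p * K) \<le> exp (- (l * M)) * (1 + l * K)"
proof -
  let ?d = "p - l"
  have "?d * K * 1 \<le> ?d * K * (l * M)"
    using assms by (intro mult_left_mono) auto
  moreover have "0 \<le> ?d * M"
    using assms by simp
  ultimately have "1 + p * K \<le> (1 + l * K) * (1 + ?d * M)"
    by (simp add: algebra_simps)
  also have "\<dots> \<le> (1 + l * K) * exp (?d * M)"
    using assms by (intro mult_left_mono exp_ge_add_one_self) auto
  finally have "exp (- (p * M)) * (1 + p * K) \<le> exp (- (p * M)) * ((1 + l * K) * exp (?d * M))"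
    by (intro mult_left_mono) auto
  also have "\<dots> = (1 + l * K) * exp (- (p * M) + ?d * M)"
    by (simp only: exp_add) simp
  also have "- (p * M) + ?d * M = - (l * M)"
    by (simp add: algebra_simps)
  finally show ?thesis
    by (simp add: mult.commute)
qed

theorem theorem7:
  fixes p :: "nat \<Rightarrow> real" and \<epsilon> :: real
  assumes "\<epsilon> > 0"
    and "\<And>n. n \<ge> 1 \<Longrightarrow> 0 \<le> p n \<and> p n \<le> 1"
    and "\<forall>\<^sub>F n in sequentially. p n \<ge> ln (real n) / (real n)\<^sup>2 * (1 + \<epsilon>)"
  shows "(\<lambda>n. let \<AA> = random_subset_pmf (Sn (n + 1)) (p n);
                   rate = measure_pmf.expectation \<AA> (\<lambda>A. real (num_uncovered n A))
               in d_TV (map_pmf (num_uncovered n) \<AA>) (Po rate)) \<longlonglongrightarrow> 0"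
    (is "?d \<longlonglongrightarrow> 0")
proof (rule tendsto_sandwich)
  define l where "l n = ln (real n) / (real n)\<^sup>2 * (1 + \<epsilon>)" for n
  define M where "M n = (real n)\<^sup>2 - 6 * real n + 1" for n
  let ?b = "\<lambda>n. exp (- (l n * M n)) * (1 + l n * (real n + 1) ^ 3)"
  show "\<forall>\<^sub>F n in sequentially. 0 \<le> ?d n"
    by (simp add: Let_def d_TV_nonneg)
  have "\<forall>\<^sub>F n in sequentially. 1 \<le> l n * M n"
    unfolding l_def M_def using assms(1) by real_asymp
  moreover have "\<forall>\<^sub>F n in sequentially. l n \<le> p n"
    using assms(3) by (simp add: l_def)
  ultimately show "\<forall>\<^sub>F n in sequentially. ?d n \<le> ?b n"
    using eventually_ge_at_top[of 6]
  proof eventually_elim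
    case (elim n)
    define m where "m = (n + 1)\<^sup>2 - 8 * n"
    have p: "0 \<le> p n" "p n \<le> 1"
      using assms(2)[of n] elim by auto
    have l: "0 \<le> l n"
      using assms(1) elim by (simp add: l_def)
    \<comment> \<open>For \<open>n \<ge> 6\<close> the natural subtraction in \<open>m\<close> is
      exact, so \<open>m\<close> agrees with the real polynomial \<open>M n\<close>.\<close>
    have "6 * n \<le> n * n"
      using elim by (intro mult_le_mono1) simp
    moreover have "(n + 1)\<^sup>2 = n * n + 2 * n + 1"
      by (simp add: power2_eq_square)
    ultimately have "m + 8 * n = (n + 1)\<^sup>2"
      unfolding m_def by linarith
    from arg_cong[OF this, of real] have m: "real m = M n"
      by (simp add: M_def power2_eq_square algebra_simps)
    have "?d n \<le> (1 - p n) ^ m * (1 + p n * (real n + 1) ^ 3)"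
      using d_TV_num_uncovered_le[OF p, of n] by (simp add: Let_def m_def)
    also have "\<dots> \<le> exp (- (p n * M n)) * (1 + p n * (real n + 1) ^ 3)"
    proof (rule mult_right_mono)
      have "(1 - p n) ^ m \<le> exp (- p n) ^ m"
        using exp_ge_add_one_self[of "- p n"] p by (intro power_mono) auto
      also have "\<dots> = exp (- (p n * M n))"
        unfolding m[symmetric] exp_of_nat_mult[symmetric] by (simp add: mult.commute)
      finally show "(1 - p n) ^ m \<le> exp (- (p n * M n))" .
    qed (use p in simp)
    also have "\<dots> \<le> ?b n"
      using elim l m[symmetric] by (intro exp_minus_mult_affine_antimono) auto
    finally show ?case .
  qed
  show "?b \<longlonglongrightarrow> 0"
  proof (rule Lim_transform_eventually)
    \<comment> \<open>The leading part of \<open>l n * M n\<close> is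
      \<open>(1 + \<epsilon>) * ln n\<close>, giving the power
      \<open>n powr (- 1 - \<epsilon>)\<close>; this factor collects the vanishing rest of the
      exponent.\<close>
    have "(\<lambda>n. exp ((1 + \<epsilon>) * ln (real n) * (6 * real n - 1) / (real n)\<^sup>2)) \<longlonglongrightarrow> 1"
      using assms(1) by real_asymp
    \<comment> \<open>Here \<open>l n * (n + 1) ^ 3\<close> grows like \<open>n * ln n\<close>, so
      the product is of order \<open>n powr (- \<epsilon>) * ln n\<close>.\<close>
    moreover have "(\<lambda>n. real n powr (- 1 - \<epsilon>) * (1 + l n * (real n + 1) ^ 3)) \<longlonglongrightarrow> 0"
      unfolding l_def using assms(1) by real_asymp
    ultimately have "(\<lambda>n. exp ((1 + \<epsilon>) * ln (real n) * (6 * real n - 1) / (real n)\<^sup>2)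
        * (real n powr (- 1 - \<epsilon>) * (1 + l n * (real n + 1) ^ 3))) \<longlonglongrightarrow> 1 * 0"
      by (rule tendsto_mult)
    then show "(\<lambda>n. exp ((1 + \<epsilon>) * ln (real n) * (6 * real n - 1) / (real n)\<^sup>2)
        * (real n powr (- 1 - \<epsilon>) * (1 + l n * (real n + 1) ^ 3))) \<longlonglongrightarrow> 0"
      by simp
    show "\<forall>\<^sub>F n in sequentially. exp ((1 + \<epsilon>) * ln (real n) * (6 * real n - 1) / (real n)\<^sup>2)
        * (real n powr (- 1 - \<epsilon>) * (1 + l n * (real n + 1) ^ 3)) = ?b n"
      using eventually_ge_at_top[of 1]
    proof eventually_elim
      case (elim n)
      have "- (l n * M n)
          = (1 + \<epsilon>) * ln (real n) * (6 * real n - 1) / (real n)\<^sup>2 + (- 1 - \<epsilon>) * ln (real n)"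
        using elim by (simp add: l_def M_def field_simps)
      then show ?case
        using elim by (simp add: powr_def exp_add)
    qed
  qed
qed simp

end
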